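(* Consider the two-node tandem network with $d=2$ and $\mathcal{Q}=\begin{pmatrix}1&0\\-1&1\end{pmatrix}$. Let $\xi\in\prod_{i=1}^{2}\mathbb{D}^{(\gamma-\mathcal{Q}r)_i}_{\leqslant\infty}[0,T]$. Then there exists a path $\tilde\xi\in\prod_{i=1}^{2}\mathbb{D}^{(\gamma-\mathcal{Q}r)_i}_{\leqslant1}[0,T]$ such that (i) $\tilde I^{(2)}(\tilde\xi)\le\tilde I^{(2)}(\xi)$, and (ii) $\phi(\tilde\xi)(T)\ge\phi(\xi)(T)$ componentwise.
   Context: Fix $T>0$. $\mathbb{D}[0,T]$ is the space of real-valued càdlàg functions on $[0,T]$; $e(t)=t$. $\mathbb{D}^{\uparrow}[0,T]$ is the set of non-decreasing $\xi\in\mathbb{D}[0,T]$ with $\xi(0)\ge0$. $\mathbb{D}^{\uparrow}_{\leqslant\infty}[0,T]$ is the set of non-decreasing pure jump functions in $\mathbb{D}[0,T]$ that are nonnegative at $0$, i.e. $\xi=\sum_{j\ge1}x^{(j)}\mathbf{1}_{[u^{(j)},T]}$ with $x^{(j)}\ge0$ and distinct $u^{(j)}\in[0,T]$; $\mathbb{D}^{\uparrow}_{\leqslant1}[0,T]=\{x\mathbf{1}_{[u,T]}:x\ge0,\ u\in[0,T]\}$. For $\beta\in\mathbb{R}$ and $k\in\{1,\infty\}$, $\mathbb{D}^{\beta}_{\leqslant k}[0,T]=\{\xi+\beta e:\xi\in\mathbb{D}^{\uparrow}_{\leqslant k}[0,T]\}$. Reflection map: for $\xi\in\mathbb{D}[0,T]^2$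 let $\Psi(\xi)=\{\zeta\in\mathbb{D}^{\uparrow}[0,T]^2:\xi+\mathcal{Q}\zeta\ge0\}$ (componentwise, pointwise), $\psi_i(\xi)(t)=\inf\{\omega_i(t):\omega\in\Psi(\xi)\}$ (it is known that $\psi(\xi)\in\Psi(\xi)$), and $\phi(\xi)=\xi+\mathcal{Q}\psi(\xi)$. Parameters: both nodes have exogenous input with mean rates $\gamma=(\gamma_1,\gamma_2)^{\top}$, $\gamma_i>0$; $r=(r_1,r_2)^{\top}$ is the vector of output rates; stability $r>\mathcal{Q}^{-1}\gamma$ holds, i.e. $r_1>\gamma_1$ and $r_2>\gamma_1+\gamma_2$. Note $\gamma-\mathcal{Q}r=(\gamma_1-r_1,\ \gamma_2+r_1-r_2)^{\top}$. Constants $\alpha\in(0,1)$ and $c_1,c_2\in(0,\infty)$ are given. Rate function: $I(\xi)=\sum_{t\in[0,T]:\,\xi(t)\ne\xi(t-)}(\xi(t)-\xi(t-))^{\alpha}$, with the convention $\xi(0-)=0$, and $\tilde I^{(2)}(\xi)=c_1I(\xi_1)+c_2I(\xi_2)$ if $\xi_j\in\mathbb{D}^{(\gamma-\mathcal{Q}r)_j}_{\leqslant\infty}[0,T]$ for $j=1,2$, and $\tilde I^{(2)}(\xi)=\infty$ otherwise. *)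

theory Defs
  imports "HOL-Analysis.Analysis"
begin

text \<open>
  A path on \<open>[0,T]\<close> is a function on all of \<open>real\<close> of which only the values on \<open>{0..T}\<close> matter:
  none of the sets below constrains a path outside \<open>{0..T}\<close>. An \<open>\<real>\<^sup>n\<close>-valued path is a function
  into \<open>real ^ 'n\<close>, and \<open>path_comp \<xi> i\<close> is its \<open>i\<close>-th coordinate path.
\<close>

definition path_comp :: "(real \<Rightarrow> real ^ 'n) \<Rightarrow> 'n \<Rightarrow> real \<Rightarrow> real" where
  "path_comp \<xi> i = (\<lambda>t. \<xi> t $ i)"

definition cadlag :: "real \<Rightarrow> (real \<Rightarrow> real) set" where
  "cadlag T = {\<xi>. (\<forall>t\<in>{0..<T}. (\<xi> \<longlongrightarrow> \<xi> t) (at_right t)) \<and>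
                  (\<forall>t\<in>{0<..T}. \<exists>l. (\<xi> \<longlongrightarrow> l) (at_left t))}"

definition cadlag_up :: "real \<Rightarrow> (real \<Rightarrow> real) set" where
  "cadlag_up T = {\<xi> \<in> cadlag T. mono_on {0..T} \<xi> \<and> 0 \<le> \<xi> 0}"

text \<open>
  Non-decreasing pure jump paths. Finitely many jumps are the case in which all but finitely many
  of the sizes \<open>x j\<close> are zero.
\<close>

definition pure_jump_up :: "real \<Rightarrow> (real \<Rightarrow> real) set" where
  "pure_jump_up T = {\<xi> \<in> cadlag_up T. \<exists>(x :: nat \<Rightarrow> real) (u :: nat \<Rightarrow> real).
      (\<forall>j. 0 \<le> x j) \<and> (\<forall>j. u j \<in> {0..T}) \<and> inj u \<and>
      (\<forall>t\<in>{0..T}. (\<lambda>j. x j * indicator {u j..T} t) sums \<xi> t)}"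

definition one_jump_up :: "real \<Rightarrow> (real \<Rightarrow> real) set" where
  "one_jump_up T = {\<xi>. \<exists>x u. 0 \<le> x \<and> u \<in> {0..T} \<and>
      (\<forall>t\<in>{0..T}. \<xi> t = x * indicator {u..T} t)}"

definition add_drift :: "real \<Rightarrow> (real \<Rightarrow> real) set \<Rightarrow> (real \<Rightarrow> real) set" where
  "add_drift \<beta> A = {(\<lambda>t. \<xi> t + \<beta> * t) | \<xi>. \<xi> \<in> A}"


text \<open>The reflection map with reflection matrix \<open>Q\<close>.\<close>

definition feasible_regulators ::
  "real \<Rightarrow> real ^ 'n ^ 'n \<Rightarrow> (real \<Rightarrow> real ^ 'n) \<Rightarrow> (real \<Rightarrow> real ^ 'n) set" where
  "feasible_regulators T Q \<xi> =
     {\<zeta>. (\<forall>i. path_comp \<zeta> i \<in> cadlag_up T) \<and> (\<forall>t\<in>{0..T}. 0 \<le> \<xi> t + Q *v \<zeta> t)}"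

definition regulator ::
  "real \<Rightarrow> real ^ 'n ^ 'n \<Rightarrow> (real \<Rightarrow> real ^ 'n) \<Rightarrow> real \<Rightarrow> real ^ 'n" where
  "regulator T Q \<xi> t = (\<chi> i. INF \<omega> \<in> feasible_regulators T Q \<xi>. \<omega> t $ i)"

definition reflected ::
  "real \<Rightarrow> real ^ 'n ^ 'n \<Rightarrow> (real \<Rightarrow> real ^ 'n) \<Rightarrow> real \<Rightarrow> real ^ 'n" where
  "reflected T Q \<xi> t = \<xi> t + Q *v regulator T Q \<xi> t"


text \<open>The two-node tandem network.\<close>

definition tandem_Q :: "real ^ 2 ^ 2" where
  "tandem_Q = vector [vector [1, 0], vector [- 1, 1]]"

text \<open>
  Stability \<open>r > Q\<^sup>-\<^sup>1 \<gamma>\<close> is spelled out by coordinates, because \<open><\<close> on \<open>real ^ 2\<close> is not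
  coordinatewise strict inequality.
\<close>

definition tandem_stable :: "real ^ 2 \<Rightarrow> real ^ 2 \<Rightarrow> bool" where
  "tandem_stable \<gamma> r \<longleftrightarrow> (\<forall>i. (matrix_inv tandem_Q *v \<gamma>) $ i < r $ i)"

definition tandem_drift :: "real ^ 2 \<Rightarrow> real ^ 2 \<Rightarrow> real ^ 2" where
  "tandem_drift \<gamma> r = \<gamma> - tandem_Q *v r"

lemma tandem_stable_iff:
  "tandem_stable \<gamma> r \<longleftrightarrow> \<gamma> $ 1 < r $ 1 \<and> \<gamma> $ 1 + \<gamma> $ 2 < r $ 2"
proof -
  define B :: "real ^ 2 ^ 2" where "B = vector [vector [1, 0], vector [1, 1]]"
  have "tandem_Q ** B = mat 1" "B ** tandem_Q = mat 1"
    by (simp_all add: tandem_Q_def B_def vec_eq_iff forall_2 matrix_matrix_mult_def mat_def sum_2)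
  then have "matrix_inv tandem_Q = B"
    unfolding matrix_inv_def
    by (intro some_equality) (auto, metis matrix_mul_assoc matrix_mul_lid matrix_mul_rid)
  then show ?thesis
    by (simp add: tandem_stable_def B_def forall_2 matrix_vector_mult_def sum_2)
qed

lemma tandem_drift_simps:
  "tandem_drift \<gamma> r $ 1 = \<gamma> $ 1 - r $ 1" "tandem_drift \<gamma> r $ 2 = \<gamma> $ 2 + r $ 1 - r $ 2"
  by (simp_all add: tandem_drift_def tandem_Q_def matrix_vector_mult_def sum_2)


text \<open>The rate function, with values in \<open>[0,\<infinity>]\<close> and the convention \<open>\<xi>(0-) = 0\<close>.\<close>

definition left_val :: "(real \<Rightarrow> real) \<Rightarrow> real \<Rightarrow> real" where
  "left_val \<xi> t = (if t = 0 then 0 else Lim (at_left t) \<xi>)"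

definition jump_cost :: "real \<Rightarrow> real \<Rightarrow> (real \<Rightarrow> real) \<Rightarrow> ennreal" where
  "jump_cost T \<alpha> \<xi> =
     (\<Sum>\<^sub>\<infinity>t\<in>{t \<in> {0..T}. \<xi> t \<noteq> left_val \<xi> t}. ennreal ((\<xi> t - left_val \<xi> t) powr \<alpha>))"

definition tandem_rate ::
  "real \<Rightarrow> real \<Rightarrow> real \<Rightarrow> real \<Rightarrow> real ^ 2 \<Rightarrow> real ^ 2 \<Rightarrow> (real \<Rightarrow> real ^ 2) \<Rightarrow> ennreal" where
  "tandem_rate T \<alpha> c1 c2 \<gamma> r \<xi> =
     (if \<forall>j. path_comp \<xi> j \<in> add_drift (tandem_drift \<gamma> r $ j) (pure_jump_up T)
      then ennreal c1 * jump_cost T \<alpha> (path_comp \<xi> 1) + ennreal c2 * jump_cost T \<alpha> (path_comp \<xi> 2)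
      else \<infinity>)"

end

theory Submission
  imports Defs
begin

text \<open>
  Write \<open>\<xi>\<^sub>1 t = J\<^sub>1 t - c t\<close> and \<open>\<xi>\<^sub>2 t = J\<^sub>2 t + b t\<close> with pure jump paths \<open>J\<^sub>1\<close>, \<open>J\<^sub>2\<close>. Stability gives
  \<open>c > 0\<close>; \<open>b\<close> may have either sign. Let \<open>p\<close> be the value at \<open>T\<close> of the first coordinate of the
  regulator of \<open>\<xi>\<close>, that is, the total idle capacity of node 1. The new path keeps the total jump
  mass of each input and merges it into one jump: the mass \<open>J\<^sub>1 T\<close> arrives at node 1 at time \<open>p / c\<close>,
  and the mass \<open>J\<^sub>2 T\<close> arrives at node 2 at time \<open>T\<close>.

  Merging does not raise the cost because \<open>x \<mapsto> x\<^sup>\<alpha>\<close> is subadditive (\<open>jump_cost_step_le_jump_cost\<close>).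

  The new path has the same value at \<open>T\<close> as \<open>\<xi>\<close>, so by \<open>\<phi>\<^sub>1 = \<xi>\<^sub>1 + \<psi>\<^sub>1\<close> and
  \<open>\<phi>\<^sub>2 = \<xi>\<^sub>2 - \<psi>\<^sub>1 + \<psi>\<^sub>2\<close> only the regulators have to be compared. Before the jump, node 1 is empty
  and its idle capacity grows at rate \<open>c\<close>; when the jump occurs, this capacity has just reached \<open>p\<close>,
  and it stays there. The first regulator of the new path is thus \<open>min (c t) p\<close>, with the
  same final value \<open>p\<close> as that of \<open>\<xi>\<close>. For \<open>\<xi>\<close>, the cumulative idle capacity at time \<open>t\<close> is at most \<open>c t\<close>
  and at most \<open>p\<close>. So the merged path withholds service from node 2 as early as possible, which,
  with the arrivals at node 2 delayed as well, only increases the push needed at node 2.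

  To make this precise without a formula for the reflection map, turn each
  regulator \<open>\<zeta>\<close> feasible for the new path into the regulator \<open>(min (c t) p, \<zeta>\<^sub>2)\<close> feasible for \<open>\<xi>\<close>
  (\<open>feasible_merged_imp_feasible\<close>). Minimality then bounds the second regulator of \<open>\<xi>\<close> by that of
  the new path.
\<close>

section \<open>The cost of jumps\<close>

text \<open>
  With \<open>S\<close> the total, \<open>S\<^sup>\<alpha> = (\<Sum>j\<in>F. x\<^sub>j S\<^bsup>\<alpha>-1\<^esup>)\<close>, and \<open>S\<^bsup>\<alpha>-1\<^esup> \<le> x\<^sub>j\<^bsup>\<alpha>-1\<^esup>\<close> for
  \<open>0 < x\<^sub>j \<le> S\<close> and \<open>\<alpha> \<le> 1\<close>.
\<close>

lemma powr_sum_le_sum_powr: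
  fixes x :: "'a \<Rightarrow> real"
  assumes "finite F" "\<And>j. j \<in> F \<Longrightarrow> 0 \<le> x j" "\<alpha> \<le> 1"
  shows "(\<Sum>j\<in>F. x j) powr \<alpha> \<le> (\<Sum>j\<in>F. x j powr \<alpha>)"
proof -
  define S where "S = (\<Sum>j\<in>F. x j)"
  have S0: "0 \<le> S" unfolding S_def by (rule sum_nonneg) (use assms in auto)
  have pw: "y powr \<alpha> = y * y powr (\<alpha> - 1)" if "0 \<le> y" for y :: real
    using that by (cases "y = 0") (simp_all add: powr_mult_base)
  have "S powr \<alpha> = (\<Sum>j\<in>F. x j * S powr (\<alpha> - 1))"
    using S0 by (simp add: pw S_def sum_distrib_right)
  also have "\<dots> \<le> (\<Sum>j\<in>F. x j powr \<alpha>)"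
  proof (rule sum_mono)
    fix j assume j: "j \<in> F"
    have "x j \<le> S" unfolding S_def using assms j by (intro member_le_sum) auto
    then show "x j * S powr (\<alpha> - 1) \<le> x j powr \<alpha>"
      using assms(2)[OF j] assms(3)
      by (cases "x j = 0") (auto simp: pw intro!: mult_left_mono powr_mono2')
  qed
  finally show ?thesis by (simp add: S_def)
qed

lemma left_val_eqI:
  assumes "t \<noteq> 0" "(f \<longlongrightarrow> l) (at_left t)"
  shows "left_val f t = l"
  using assms by (simp add: left_val_def tendsto_Lim)

lemma sums_nonneg_ge_term:
  fixes f :: "nat \<Rightarrow> real"
  assumes "f sums s" "\<And>i. 0 \<le> f i"
  shows "f j \<le> s"
  using sum_le_suminf[OF sums_summable[OF assms(1)], of "{j}"] assms
  by (simp add: sums_iff)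

text \<open>
  For \<open>t < u\<^sub>j\<close> the increment \<open>J (u\<^sub>j) - J t\<close> contains the summand \<open>x\<^sub>j\<close>; the claim is the limit as \<open>t\<close>
  increases to \<open>u\<^sub>j\<close>. A jump at time \<open>0\<close> is measured from \<open>0\<close>, where
  the value of \<open>J\<close> already contains the summand.
\<close>

lemma jump_ge_summand:
  assumes cad: "J \<in> cadlag_up T"
    and x: "\<And>j. 0 \<le> x j" and u: "\<And>j. u j \<in> {0..T}"
    and J: "\<And>t. t \<in> {0..T} \<Longrightarrow> (\<lambda>j. x j * indicator {u j..T} t) sums J t"
  shows "x j \<le> J (u j) + \<beta> * u j - left_val (\<lambda>t. J t + \<beta> * t) (u j)"
proof (cases "u j = 0")
  case True
  have "(\<lambda>i. x i * indicator {u i..T} (u j)) sums J (u j)" by (rule J[OF u])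
  then have "x j * indicator {u j..T} (u j) \<le> J (u j)"
    by (rule sums_nonneg_ge_term) (use x in auto)
  then show ?thesis using True u[of j] by (simp add: left_val_def)
next
  case False
  then have pos: "0 < u j" "u j \<le> T" using u[of j] by auto
  then obtain l where l: "(J \<longlongrightarrow> l) (at_left (u j))"
    using cad unfolding cadlag_up_def cadlag_def by fastforce
  have gap: "J t \<le> J (u j) - x j" if t: "0 \<le> t" "t < u j" for t
  proof -
    let ?d = "\<lambda>i. x i * indicator {u i..T} (u j) - x i * indicator {u i..T} t"
    have "?d sums (J (u j) - J t)"
      by (intro sums_diff J) (use t pos in auto)
    then have "?d j \<le> J (u j) - J t"
      by (rule sums_nonneg_ge_term) (use x t pos in \<open>auto simp: indicator_def\<close>)
    then show ?thesis using t pos by simp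
  qed
  have "eventually (\<lambda>t. J t \<le> J (u j) - x j) (at_left (u j))"
    using eventually_at_left_real[OF pos(1)] by eventually_elim (use gap in auto)
  then have le: "l \<le> J (u j) - x j"
    by (intro tendsto_upperbound[OF l]) auto
  have "left_val (\<lambda>t. J t + \<beta> * t) (u j) = l + \<beta> * u j"
    by (intro left_val_eqI False tendsto_intros l)
  then show ?thesis using le by simp
qed

text \<open>
  By subadditivity, any finitely many jumps cost at least the cost of a single jump of their total
  size, and these totals tend to \<open>J T\<close>.
\<close>

lemma jump_cost_ge_total_powr:
  assumes "J \<in> pure_jump_up T" "0 \<le> T" "0 < \<alpha>" "\<alpha> \<le> 1"
  shows "ennreal (J T powr \<alpha>) \<le> jump_cost T \<alpha> (\<lambda>t. J t + \<beta> * t)"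
proof -
  obtain x u where cad: "J \<in> cadlag_up T" and x: "\<And>j. 0 \<le> x j"
    and u: "\<And>j. u j \<in> {0..T}" and inj: "inj u"
    and J: "\<And>t. t \<in> {0..T} \<Longrightarrow> (\<lambda>j. x j * indicator {u j..T} t) sums J t"
    using assms(1) unfolding pure_jump_up_def by blast
  define \<eta> where "\<eta> = (\<lambda>t. J t + \<beta> * t)"
  have jump: "x j \<le> \<eta> (u j) - left_val \<eta> (u j)" for j
    unfolding \<eta>_def by (rule jump_ge_summand[OF cad x u J])
  let ?D = "{t \<in> {0..T}. \<eta> t \<noteq> left_val \<eta> t}"
  let ?g = "\<lambda>t. ennreal ((\<eta> t - left_val \<eta> t) powr \<alpha>)"
  have partial: "ennreal ((\<Sum>j<n. x j) powr \<alpha>) \<le> jump_cost T \<alpha> \<eta>" for n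
  proof -
    \<comment> \<open>Vanishing summands are left out because they need not produce a point of discontinuity.\<close>
    define F where "F = {j. j < n \<and> 0 < x j}"
    have F: "finite F" by (simp add: F_def)
    have "(\<Sum>j<n. x j) = (\<Sum>j\<in>F. x j)"
      using x by (intro sum.mono_neutral_right) (auto simp: F_def not_less intro: order.antisym)
    then have "ennreal ((\<Sum>j<n. x j) powr \<alpha>) \<le> ennreal (\<Sum>j\<in>F. x j powr \<alpha>)"
      using powr_sum_le_sum_powr[OF F x assms(4)] by (simp add: ennreal_leI)
    also have "\<dots> = (\<Sum>j\<in>F. ennreal (x j powr \<alpha>))" by simp
    also have "\<dots> \<le> (\<Sum>j\<in>F. ?g (u j))"
      using x jump assms(3) by (intro sum_mono ennreal_leI powr_mono2) auto
    also have "\<dots> = (\<Sum>t\<in>u ` F. ?g t)"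
      using inj by (simp add: sum.reindex inj_on_subset)
    also have "\<dots> \<le> (\<Sum>\<^sub>\<infinity>t\<in>?D. ?g t)"
    proof -
      have "t \<in> ?D" if "t \<in> u ` F" for t
      proof -
        obtain j where "t = u j" "0 < x j" using \<open>t \<in> u ` F\<close> by (auto simp: F_def)
        then show ?thesis using u[of j] jump[of j] by auto
      qed
      then have "u ` F \<in> {G. finite G \<and> G \<subseteq> ?D}" using F by blast
      then show ?thesis
        by (subst nonneg_infsum_complete) (auto intro: SUP_upper)
    qed
    finally show ?thesis by (simp add: jump_cost_def)
  qed
  have "x sums J T"
    using J[of T] u assms(2) by (simp add: indicator_def)
  then have "(\<lambda>n. \<Sum>j<n. x j) \<longlonglongrightarrow> J T" by (simp add: sums_def)
  then have "(\<lambda>n. (\<Sum>j<n. x j) powr \<alpha>) \<longlonglongrightarrow> J T powr \<alpha>"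
    using assms(3) x by (intro tendsto_powr') (auto intro!: always_eventually sum_nonneg)
  then have "(\<lambda>n. ennreal ((\<Sum>j<n. x j) powr \<alpha>)) \<longlonglongrightarrow> ennreal (J T powr \<alpha>)"
    by (rule tendsto_ennrealI)
  then show ?thesis
    unfolding \<eta>_def[symmetric] by (rule LIMSEQ_le_const2) (use partial in auto)
qed

section \<open>Paths with a single jump\<close>

lemma tendsto_step_at_left:
  fixes x u t T :: real
  assumes "t \<le> T"
  shows "((\<lambda>s. x * indicator {u..T} s) \<longlongrightarrow> (if u < t then x else 0)) (at_left t)"
proof (rule tendsto_eventually)
  show "eventually (\<lambda>s. x * indicator {u..T} s = (if u < t then x else 0)) (at_left t)"
  proof (cases "u < t")
    case True
    show ?thesis
      using eventually_at_left_real[OF True] by eventually_elim (use True assms in auto)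
  next
    case False
    have "eventually (\<lambda>s. s < t) (at_left t)" by (simp add: eventually_at_filter)
    then show ?thesis by eventually_elim (use False in auto)
  qed
qed

lemma step_in_cadlag_up:
  assumes "0 \<le> x"
  shows "(\<lambda>t. x * indicator {u..T} t) \<in> cadlag_up T"
proof -
  have "((\<lambda>s. x * indicator {u..T} s) \<longlongrightarrow> x * indicator {u..T} t) (at_right t)"
    if "t < T" for t
  proof (rule tendsto_eventually)
    show "eventually (\<lambda>s. x * indicator {u..T} s = x * indicator {u..T} t) (at_right t)"
    proof (cases "t < u")
      case True
      show ?thesis
        using eventually_at_right_real[OF True] by eventually_elim (use True in auto)
    next
      case False
      show ?thesis
        using eventually_at_right_real[OF that] by eventually_elim (use False in auto)
    qed
  qed
  moreover have "\<exists>l. ((\<lambda>s. x * indicator {u..T} s) \<longlongrightarrow> l) (at_left t)" if "t \<le> T" for t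
    using tendsto_step_at_left[OF that] by blast
  moreover have "mono_on {0..T} (\<lambda>t. x * indicator {u..T} t)"
    using assms by (auto simp: mono_on_def indicator_def)
  ultimately show ?thesis
    using assms by (simp add: cadlag_up_def cadlag_def)
qed

lemma step_in_pure_jump_up:
  assumes "0 < T" "0 \<le> x" "u \<in> {0..T}"
  shows "(\<lambda>t. x * indicator {u..T} t) \<in> pure_jump_up T"
proof -
  \<comment> \<open>The representation of a pure jump path asks for a sequence of distinct jump times, so the
     single jump is padded with jumps of size zero at arbitrary other times.\<close>
  have "infinite ({0..T} - {u})"
    using assms(1) by (simp add: infinite_Icc)
  then obtain f :: "nat \<Rightarrow> real" where f: "inj f" "range f \<subseteq> {0..T} - {u}"
    using infinite_countable_subset by blast
  define y :: "nat \<Rightarrow> real" where "y j = (if j = 0 then x else 0)" for j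
  define v where "v j = (case j of 0 \<Rightarrow> u | Suc k \<Rightarrow> f k)" for j
  have "inj v"
    using f by (simp add: inj_def v_def split: nat.splits) blast
  moreover have "v j \<in> {0..T}" for j
  proof (cases j)
    case (Suc k)
    have "f k \<in> {0..T}" using f(2) by blast
    then show ?thesis by (simp add: v_def Suc)
  qed (use assms(3) in \<open>simp add: v_def\<close>)
  moreover have "(\<lambda>j. y j * indicator {v j..T} t) sums (x * indicator {u..T} t)" for t
    using sums_finite[of "{0}" "\<lambda>j. y j * indicator {v j..T} t"] by (simp add: y_def v_def)
  moreover have "0 \<le> y j" for j
    using assms(2) by (simp add: y_def)
  ultimately have "(\<forall>j. 0 \<le> y j) \<and> (\<forall>j. v j \<in> {0..T}) \<and> inj v \<and>
      (\<forall>t\<in>{0..T}. (\<lambda>j. y j * indicator {v j..T} t) sums (x * indicator {u..T} t))"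
    by blast
  then show ?thesis
    unfolding pure_jump_up_def using step_in_cadlag_up[OF assms(2)] by blast
qed

lemma jump_cost_step_le:
  assumes "u \<in> {0..T}"
  shows "jump_cost T \<alpha> (\<lambda>t. x * indicator {u..T} t + \<beta> * t) \<le> ennreal (x powr \<alpha>)"
proof -
  define \<eta> where "\<eta> = (\<lambda>t. x * indicator {u..T} t + \<beta> * t)"
  have left: "left_val \<eta> t = (if u < t then x else 0) + \<beta> * t" if "0 \<le> t" "t \<le> T" for t
  proof (cases "t = 0")
    case True
    then show ?thesis using assms by (simp add: left_val_def)
  next
    case False
    show ?thesis
      unfolding \<eta>_def
      by (intro left_val_eqI[OF False] tendsto_add tendsto_step_at_left that tendsto_intros)
  qed
  let ?D = "{t \<in> {0..T}. \<eta> t \<noteq> left_val \<eta> t}"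
  have "\<eta> t = left_val \<eta> t" if "t \<in> {0..T}" "t \<noteq> u" for t
    using that left[of t] by (simp add: \<eta>_def indicator_def)
  then have "?D \<subseteq> {u}" by blast
  then consider "?D = {}" | "?D = {u}" by blast
  then have "jump_cost T \<alpha> \<eta> \<le> ennreal (x powr \<alpha>)"
  proof cases
    case 1
    then have "jump_cost T \<alpha> \<eta> = 0" by (simp only: jump_cost_def infsum_empty)
    then show ?thesis by simp
  next
    case 2
    have "jump_cost T \<alpha> \<eta> = ennreal ((\<eta> u - left_val \<eta> u) powr \<alpha>)"
      unfolding jump_cost_def 2 by simp
    also have "\<eta> u - left_val \<eta> u = x"
      using assms by (simp add: left) (simp add: \<eta>_def)
    finally show ?thesis by simp
  qed
  then show ?thesis by (simp add: \<eta>_def)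
qed

lemma jump_cost_step_le_jump_cost:
  assumes "J \<in> pure_jump_up T" "0 < \<alpha>" "\<alpha> \<le> 1" "u \<in> {0..T}"
  shows "jump_cost T \<alpha> (\<lambda>t. J T * indicator {u..T} t + \<beta> * t)
           \<le> jump_cost T \<alpha> (\<lambda>t. J t + \<beta> * t)"
  using jump_cost_step_le[OF assms(4)] jump_cost_ge_total_powr[OF assms(1) _ assms(2,3)] assms(4)
  by (meson atLeastAtMost_iff order_trans)

section \<open>Regulators of the tandem network\<close>

lemma tandem_Q_mult:
  "(tandem_Q *v z) $ 1 = z $ 1" "(tandem_Q *v z) $ 2 = z $ 2 - z $ 1"
  by (simp_all add: tandem_Q_def matrix_vector_mult_def sum_2)

lemma tandem_feasible_iff:
  "\<zeta> \<in> feasible_regulators T tandem_Q \<xi> \<longleftrightarrow>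
     path_comp \<zeta> 1 \<in> cadlag_up T \<and> path_comp \<zeta> 2 \<in> cadlag_up T \<and>
     (\<forall>t\<in>{0..T}. 0 \<le> \<xi> t $ 1 + \<zeta> t $ 1 \<and> \<zeta> t $ 1 \<le> \<xi> t $ 2 + \<zeta> t $ 2)"
  by (auto simp: feasible_regulators_def forall_2 less_eq_vec_def tandem_Q_mult algebra_simps)

lemma continuous_mono_in_cadlag_up:
  assumes "continuous_on UNIV f" "mono f" "0 \<le> f 0"
  shows "f \<in> cadlag_up T"
proof -
  have "(f \<longlongrightarrow> f t) (at t within A)" for t A
    using assms(1) by (metis UNIV_I continuous_on_def subset_UNIV tendsto_within_subset)
  then show ?thesis
    using assms(2,3) unfolding cadlag_up_def cadlag_def
    by (auto simp: mono_on_def mono_def)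
qed

lemma cadlag_up_mono:
  assumes "f \<in> cadlag_up T" "0 \<le> s" "s \<le> t" "t \<le> T"
  shows "f s \<le> f t"
  using assms by (auto simp: cadlag_up_def mono_on_def)

lemma cadlag_up_nonneg:
  assumes "f \<in> cadlag_up T" "0 \<le> t" "t \<le> T"
  shows "0 \<le> f t"
  using cadlag_up_mono[OF assms(1), of 0 t] assms by (auto simp: cadlag_up_def)

lemma regulator_le:
  assumes "\<zeta> \<in> feasible_regulators T Q \<xi>" "0 \<le> t" "t \<le> T"
  shows "regulator T Q \<xi> t $ i \<le> \<zeta> t $ i"
proof -
  have "bdd_below ((\<lambda>\<omega>. \<omega> t $ i) ` feasible_regulators T Q \<xi>)"
  proof (rule bdd_belowI2[of _ 0])
    fix \<omega> assume "\<omega> \<in> feasible_regulators T Q \<xi>"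
    then have "path_comp \<omega> i \<in> cadlag_up T" by (simp add: feasible_regulators_def)
    then show "0 \<le> \<omega> t $ i"
      using cadlag_up_nonneg[OF _ assms(2,3)] by (force simp: path_comp_def)
  qed
  then show ?thesis
    unfolding regulator_def
    using cINF_lower[of "\<lambda>\<omega>. \<omega> t $ i", OF _ assms(1)] by simp
qed

lemma regulator_geI:
  assumes "\<zeta> \<in> feasible_regulators T Q \<xi>"
    and "\<And>\<omega>. \<omega> \<in> feasible_regulators T Q \<xi> \<Longrightarrow> m \<le> \<omega> t $ i"
  shows "m \<le> regulator T Q \<xi> t $ i"
  unfolding regulator_def using assms by (auto intro!: cINF_greatest)

lemma path_comp_vector:
  "path_comp (\<lambda>t. vector [f t, g t] :: real ^ 2) 1 = f"
  "path_comp (\<lambda>t. vector [f t, g t] :: real ^ 2) 2 = g"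
  by (simp_all add: path_comp_def)

lemma capped_line_in_cadlag_up:
  fixes c p :: real
  assumes "0 \<le> c" "0 \<le> p"
  shows "(\<lambda>t. min (c * t) p) \<in> cadlag_up T"
  using assms
  by (intro continuous_mono_in_cadlag_up continuous_intros)
     (auto simp: mono_def intro!: min.coboundedI1 mult_left_mono)

lemma linear_in_cadlag_up:
  fixes c p :: real
  assumes "0 \<le> c" "0 \<le> p"
  shows "(\<lambda>t. c * t + p) \<in> cadlag_up T"
  using assms
  by (intro continuous_mono_in_cadlag_up continuous_intros)
     (auto simp: mono_def intro!: mult_left_mono)

section \<open>Merging the jumps of each input\<close>

locale tandem_input =
  fixes T c b :: real and J1 J2 :: "real \<Rightarrow> real" and \<xi> :: "real \<Rightarrow> real ^ 2"
  assumes T: "0 < T" and c: "0 < c"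
    and J1: "J1 \<in> cadlag_up T" and J2: "J2 \<in> cadlag_up T"
    and path: "\<And>t. \<xi> t $ 1 = J1 t - c * t" "\<And>t. \<xi> t $ 2 = J2 t + b * t"
begin

definition idle :: real where
  "idle = regulator T tandem_Q \<xi> T $ 1"

text \<open>
  The jump of node 1 is placed at the time at which an empty node 1, idling at rate \<open>c\<close>, has
  accumulated the whole idle capacity of \<open>\<xi>\<close>. The jump of node 2 comes at the last possible moment,
  where it can no longer replace any push.
\<close>

definition merged :: "real \<Rightarrow> real ^ 2" where
  "merged t = vector [J1 T * indicator {idle / c..T} t - c * t, J2 T * indicator {T..T} t + b * t]"

lemma merged_simps:
  "merged t $ 1 = J1 T * indicator {idle / c..T} t - c * t"
  "merged t $ 2 = J2 T * indicator {T..T} t + b * t"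
  by (simp_all add: merged_def)

text \<open>
  Pushing node 1 at rate \<open>c\<close> cancels its negative drift; node 2 must then make up for both this
  push and its own drift. The existence of one feasible regulator is what makes the infima that
  define \<open>regulator\<close> meaningful.
\<close>

lemma linear_feasible:
  "(\<lambda>t. vector [c * t, (c + \<bar>b\<bar>) * t]) \<in> feasible_regulators T tandem_Q \<xi>"
  unfolding tandem_feasible_iff path_comp_vector vector_2
proof (intro conjI ballI)
  show "(\<lambda>t. c * t) \<in> cadlag_up T" "(\<lambda>t. (c + \<bar>b\<bar>) * t) \<in> cadlag_up T"
    using linear_in_cadlag_up[of c 0] linear_in_cadlag_up[of "c + \<bar>b\<bar>" 0] c by simp_all
  fix t assume t: "t \<in> {0..T}"
  show "0 \<le> \<xi> t $ 1 + c * t"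
    using cadlag_up_nonneg[OF J1, of t] t by (simp add: path)
  have "- b * t \<le> \<bar>b\<bar> * t" using t by (intro mult_right_mono) auto
  then show "c * t \<le> \<xi> t $ 2 + (c + \<bar>b\<bar>) * t"
    using cadlag_up_nonneg[OF J2, of t] t by (simp add: path algebra_simps)
qed

text \<open>
  A feasible first regulator \<open>\<omega>\<^sub>1\<close> satisfies \<open>- \<xi>\<^sub>1 t \<le> \<omega>\<^sub>1 t \<le> \<omega>\<^sub>1 T\<close>, and \<open>idle\<close> is the infimum of the
  right-hand sides.
\<close>

lemma neg_first_le_idle:
  assumes t: "t \<in> {0..T}"
  shows "- \<xi> t $ 1 \<le> idle"
  unfolding idle_def
proof (rule regulator_geI[OF linear_feasible])
  fix \<omega> assume "\<omega> \<in> feasible_regulators T tandem_Q \<xi>"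
  then have "path_comp \<omega> 1 \<in> cadlag_up T" "0 \<le> \<xi> t $ 1 + \<omega> t $ 1"
    using t by (auto simp: tandem_feasible_iff)
  then show "- \<xi> t $ 1 \<le> \<omega> T $ 1"
    using cadlag_up_mono[of "path_comp \<omega> 1" T t T] t by (auto simp: path_comp_def)
qed

lemma idle_nonneg: "0 \<le> idle"
  unfolding idle_def
proof (rule regulator_geI[OF linear_feasible])
  fix \<omega> assume "\<omega> \<in> feasible_regulators T tandem_Q \<xi>"
  then have "path_comp \<omega> 1 \<in> cadlag_up T" by (auto simp: tandem_feasible_iff)
  then show "0 \<le> \<omega> T $ 1"
    using cadlag_up_nonneg[of "path_comp \<omega> 1" T T] T by (simp add: path_comp_def)
qed

lemma idle_le: "idle \<le> c * T"
  using regulator_le[OF linear_feasible, of T 1] T by (simp add: idle_def)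

lemma merged_jump_time: "idle / c \<in> {0..T}"
  using idle_nonneg idle_le c by (simp add: field_simps)

text \<open>
  Before the jump, feasibility at node 1 reads \<open>c t \<le> \<zeta>\<^sub>1 t\<close>. The line \<open>c t\<close> tends to \<open>idle\<close> at the jump
  time, so monotonicity of \<open>\<zeta>\<^sub>1\<close> preserves the level \<open>idle\<close> from there on.
\<close>

lemma capped_line_le_regulator:
  assumes \<zeta>: "\<zeta> \<in> feasible_regulators T tandem_Q merged" and t: "t \<in> {0..T}"
  shows "min (c * t) idle \<le> \<zeta> t $ 1"
proof -
  have cad: "path_comp \<zeta> 1 \<in> cadlag_up T"
    using \<zeta> by (simp add: tandem_feasible_iff)
  have before: "c * s \<le> \<zeta> s $ 1" if "0 \<le> s" "s < idle / c" for s
  proof -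
    have "0 \<le> merged s $ 1 + \<zeta> s $ 1"
      using \<zeta> that merged_jump_time by (simp add: tandem_feasible_iff)
    then show ?thesis using that by (simp add: merged_simps)
  qed
  show ?thesis
  proof (cases "t < idle / c")
    case True
    then show ?thesis using before[of t] t by simp
  next
    case False
    have "idle \<le> \<zeta> t $ 1"
    proof (cases "idle = 0")
      case True
      then show ?thesis using cadlag_up_nonneg[OF cad, of t] t by (simp add: path_comp_def)
    next
      case nz: False
      then have "0 < idle" using idle_nonneg by simp
      then show ?thesis
      proof (rule dense_le_bounded)
        fix w assume w: "0 < w" "w < idle"
        then have "w / c < idle / c" using c by (simp add: divide_strict_right_mono)
        then have "w \<le> \<zeta> (w / c) $ 1" using before[of "w / c"] w c by simp
        also have "\<dots> \<le> \<zeta> t $ 1"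
          using cadlag_up_mono[OF cad, of "w / c" t] \<open>w / c < idle / c\<close> False t w c
          by (simp add: path_comp_def)
        finally show "w \<le> \<zeta> t $ 1" .
      qed
    qed
    then show ?thesis by simp
  qed
qed

text \<open>
  This transfer carries the comparison of the two networks. At node 1, \<open>c t\<close> and \<open>idle\<close> each suffice
  to keep \<open>\<xi>\<^sub>1\<close> nonnegative, hence so does their minimum. At node 2, passing from \<open>merged\<close> to \<open>\<xi>\<close> with
  this regulator lowers the amount withheld by node 1 (\<open>capped_line_le_regulator\<close>) and brings
  arrivals forward, so the push \<open>\<zeta>\<^sub>2\<close> remains sufficient.
\<close>

lemma feasible_merged_imp_feasible:
  assumes \<zeta>: "\<zeta> \<in> feasible_regulators T tandem_Q merged"
  shows "(\<lambda>t. vector [min (c * t) idle, \<zeta> t $ 2]) \<in> feasible_regulators T tandem_Q \<xi>"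
  unfolding tandem_feasible_iff path_comp_vector vector_2
proof (intro conjI ballI capped_line_in_cadlag_up)
  show "(\<lambda>t. \<zeta> t $ 2) \<in> cadlag_up T"
    using \<zeta> by (simp add: tandem_feasible_iff path_comp_def)
  fix t assume t: "t \<in> {0..T}"
  show "0 \<le> \<xi> t $ 1 + min (c * t) idle"
    using neg_first_le_idle[OF t] cadlag_up_nonneg[OF J1, of t] t by (auto simp: path min_def)
  have "\<zeta> t $ 1 \<le> J2 T * indicator {T..T} t + b * t + \<zeta> t $ 2"
    using \<zeta> t by (simp add: tandem_feasible_iff merged_simps)
  moreover have "J2 T * indicator {T..T} t \<le> J2 t"
    using cadlag_up_nonneg[OF J2, of t] t by (cases "t = T") auto
  ultimately show "min (c * t) idle \<le> \<xi> t $ 2 + \<zeta> t $ 2"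
    using capped_line_le_regulator[OF \<zeta> t] by (simp add: path)
qed (use c idle_nonneg in auto)

text \<open>
  The capped line is thus the least first regulator of \<open>merged\<close>. The second coordinate only
  has to be large enough: \<open>\<bar>b\<bar> t\<close> absorbs the drift of node 2 and \<open>idle\<close> the push at node 1.
\<close>

lemma capped_line_feasible_merged:
  "(\<lambda>t. vector [min (c * t) idle, \<bar>b\<bar> * t + idle]) \<in> feasible_regulators T tandem_Q merged"
  unfolding tandem_feasible_iff path_comp_vector vector_2
proof (intro conjI ballI capped_line_in_cadlag_up linear_in_cadlag_up)
  fix t assume t: "t \<in> {0..T}"
  have J: "0 \<le> J1 T" "0 \<le> J2 T" using cadlag_up_nonneg J1 J2 T by (simp_all add: less_imp_le)
  have "c * t \<le> c * T" using t c by simp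
  \<comment> \<open>The value \<open>idle\<close> is at least \<open>- \<xi> T $ 1 = c T - J1 T\<close>, so once the merged jump has occurred
     node 1 needs no further push up to time \<open>T\<close>.\<close>
  then have after: "c * t \<le> J1 T + idle" using neg_first_le_idle[of T] T by (simp add: path)
  show "0 \<le> merged t $ 1 + min (c * t) idle"
  proof (cases "t < idle / c")
    case True
    then show ?thesis using c by (simp add: merged_simps field_simps min_def)
  next
    case False
    then show ?thesis using J after t by (simp add: merged_simps min_def)
  qed
  have "- b * t \<le> \<bar>b\<bar> * t" using t by (intro mult_right_mono) auto
  moreover have "0 \<le> J2 T * indicator {T..T} t" using J by simp
  ultimately show "min (c * t) idle \<le> merged t $ 2 + (\<bar>b\<bar> * t + idle)"
    by (simp add: merged_simps)
qed (use c idle_nonneg in auto)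

lemma regulator_merged_first: "regulator T tandem_Q merged T $ 1 = idle"
proof (rule antisym)
  show "regulator T tandem_Q merged T $ 1 \<le> idle"
    using regulator_le[OF capped_line_feasible_merged, of T 1] T by simp
  show "idle \<le> regulator T tandem_Q merged T $ 1"
  proof (rule regulator_geI[OF capped_line_feasible_merged])
    fix \<omega> assume "\<omega> \<in> feasible_regulators T tandem_Q merged"
    then show "idle \<le> \<omega> T $ 1"
      using capped_line_le_regulator[of \<omega> T] idle_le T by simp
  qed
qed

lemma regulator_le_merged_second:
  "regulator T tandem_Q \<xi> T $ 2 \<le> regulator T tandem_Q merged T $ 2"
proof (rule regulator_geI[OF capped_line_feasible_merged])
  fix \<omega> assume "\<omega> \<in> feasible_regulators T tandem_Q merged"
  then show "regulator T tandem_Q \<xi> T $ 2 \<le> \<omega> T $ 2"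
    using regulator_le[OF feasible_merged_imp_feasible, of \<omega> T 2] T by simp
qed

lemma reflected_le_merged: "reflected T tandem_Q \<xi> T \<le> reflected T tandem_Q merged T"
proof -
  have "\<xi> T = merged T"
    using merged_jump_time T by (simp add: vec_eq_iff forall_2 path merged_simps)
  then show ?thesis
    using regulator_merged_first regulator_le_merged_second
    by (simp add: reflected_def less_eq_vec_def forall_2 tandem_Q_mult idle_def)
qed

end

theorem lemma5p1:
  fixes T \<alpha> c1 c2 :: real and \<gamma> r :: "real ^ 2" and \<xi> :: "real \<Rightarrow> real ^ 2"
  assumes "0 < T"
    and "0 < \<alpha>" and "\<alpha> < 1"
    and "0 < c1" and "0 < c2"
    and "\<And>i. 0 < \<gamma> $ i"
    and "tandem_stable \<gamma> r"
    and "\<And>i. path_comp \<xi> i \<in> add_drift (tandem_drift \<gamma> r $ i) (pure_jump_up T)"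
  shows "\<exists>\<xi>'. (\<forall>i. path_comp \<xi>' i \<in> add_drift (tandem_drift \<gamma> r $ i) (one_jump_up T)) \<and>
           tandem_rate T \<alpha> c1 c2 \<gamma> r \<xi>' \<le> tandem_rate T \<alpha> c1 c2 \<gamma> r \<xi> \<and>
           reflected T tandem_Q \<xi> T \<le> reflected T tandem_Q \<xi>' T"
proof -
  let ?\<beta> = "tandem_drift \<gamma> r"
  obtain J1 where j1: "J1 \<in> pure_jump_up T" "path_comp \<xi> 1 = (\<lambda>t. J1 t + ?\<beta> $ 1 * t)"
    using assms(8)[of 1] by (auto simp: add_drift_def)
  obtain J2 where j2: "J2 \<in> pure_jump_up T" "path_comp \<xi> 2 = (\<lambda>t. J2 t + ?\<beta> $ 2 * t)"
    using assms(8)[of 2] by (auto simp: add_drift_def)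
  have cad: "J1 \<in> cadlag_up T" "J2 \<in> cadlag_up T"
    using j1(1) j2(1) by (auto simp: pure_jump_up_def)
  interpret tandem_input T "- ?\<beta> $ 1" "?\<beta> $ 2" J1 J2 \<xi>
  proof
    show "0 < - ?\<beta> $ 1"
      using assms(7) by (simp add: tandem_stable_iff tandem_drift_simps)
    show "\<xi> t $ 1 = J1 t - - ?\<beta> $ 1 * t" "\<xi> t $ 2 = J2 t + ?\<beta> $ 2 * t" for t
      using j1(2) j2(2) by (simp_all add: path_comp_def fun_eq_iff)
  qed (use assms(1) cad in auto)
  let ?u = "idle / - ?\<beta> $ 1"
  have comp: "path_comp merged 1 = (\<lambda>t. J1 T * indicator {?u..T} t + ?\<beta> $ 1 * t)"
    "path_comp merged 2 = (\<lambda>t. J2 T * indicator {T..T} t + ?\<beta> $ 2 * t)"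
    by (simp_all add: path_comp_def merged_simps)
  have J: "0 \<le> J1 T" "0 \<le> J2 T" using cadlag_up_nonneg cad assms(1) by (simp_all add: less_imp_le)
  have time: "?u \<in> {0..T}" "T \<in> {0..T}" using merged_jump_time assms(1) by auto
  have drift: "(\<lambda>t. f t + \<beta> * t) \<in> add_drift \<beta> A" if "f \<in> A" for f \<beta> A
    using that by (auto simp: add_drift_def)
  have step: "(\<lambda>t. x * indicator {u..T} t) \<in> one_jump_up T" if "0 \<le> x" "u \<in> {0..T}" for x u
    using that by (auto simp: one_jump_up_def)
  have "\<forall>i. path_comp merged i \<in> add_drift (?\<beta> $ i) (one_jump_up T)"
    unfolding forall_2 comp using J time by (intro conjI drift step)
  moreover have "tandem_rate T \<alpha> c1 c2 \<gamma> r merged \<le> tandem_rate T \<alpha> c1 c2 \<gamma> r \<xi>"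
  proof -
    have "\<forall>i. path_comp merged i \<in> add_drift (?\<beta> $ i) (pure_jump_up T)"
      unfolding forall_2 comp using J time assms(1) by (intro conjI drift step_in_pure_jump_up)
    moreover have "jump_cost T \<alpha> (path_comp merged i) \<le> jump_cost T \<alpha> (path_comp \<xi> i)" for i
    proof -
      have "jump_cost T \<alpha> (path_comp merged 1) \<le> jump_cost T \<alpha> (path_comp \<xi> 1)"
        "jump_cost T \<alpha> (path_comp merged 2) \<le> jump_cost T \<alpha> (path_comp \<xi> 2)"
        unfolding comp j1(2) j2(2) using j1(1) j2(1) time assms(2,3)
        by (intro jump_cost_step_le_jump_cost; simp)+
      then show ?thesis using exhaust_2[of i] by auto
    qed
    ultimately show ?thesis
      using assms(8) by (simp add: tandem_rate_def add_mono mult_left_mono)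
  qed
  ultimately show ?thesis using reflected_le_merged by blast
qed

end
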